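(* Let $s$ be a positive integer, let $F$ be a continuous distribution function on $\mathbb{R}$, and let $$\alpha_1=1,\qquad \alpha_i=\prod_{j=2}^{i}\frac{1+(j-2)^s}{(j-1)^s}\quad (i=2,3,\ldots).$$ Let $X_1,X_2,\ldots$ be independent real random variables such that $X_i$ has distribution function $F(x)^{\alpha_i}$ for each $i\ge 1$. For $n\ge 1$, let $N_n$ be the number of records among $X_1,\ldots,X_n$. Then for all integers $n\ge 1$ and $1\le k\le n$, $$P(N_n=k)=\frac{S_s(n,k)}{\prod_{i=1}^{n}\bigl(1+(i-1)^s\bigr)},$$ where $S_s(n,k)$ denotes the Stirling number of the first kind with level $s$.
   Context: For a positive integer $s$, the Stirling numbers of the first kind with level $s$, written $S_s(n,k)$, are defined for integers $0\le k\le n$ by the polynomial identity $$\prod_{i=0}^{n-1}(x+i^s)=\sum_{k=0}^{n}S_s(n,k)\,x^k,\qquad n\ge 0,$$ where the empty product is $1$. For a sequence of random variables $X_1,X_2,\ldots$, the variable $X_j$ is called a record (upper record) if $X_j>X_i$ for all $i=1,\ldots,j-1$; by convention $X_1$ is a record. *)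

theory Defs
  imports
    "HOL-Probability.Probability"
    "HOL-Computational_Algebra.Polynomial"
begin

definition stirling_level :: "nat \<Rightarrow> nat \<Rightarrow> nat \<Rightarrow> nat" where
  "stirling_level s n k = coeff (\<Prod>i<n. [:i ^ s, 1:]) k"

lemma stirling_level_gf:
  fixes x :: "'a::comm_semiring_1"
  shows "(\<Prod>i<n. (x + of_nat i ^ s)) = (\<Sum>k\<le>n. of_nat (stirling_level s n k) * x ^ k)"
proof (induction n)
  case 0
  show ?case by (simp add: stirling_level_def)
next
  case (Suc n)
  have rec: "stirling_level s (Suc n) k =
      n ^ s * stirling_level s n k + (case k of 0 \<Rightarrow> 0 | Suc j \<Rightarrow> stirling_level s n j)" for k
    by (simp add: stirling_level_def mult.commute [of _ "[:n ^ s, 1:]"] coeff_pCons split: nat.split)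
  have deg: "degree (\<Prod>i<n. [:i ^ s, 1:] :: nat poly) \<le> n"
    using degree_prod_sum_le [of "{..<n}" "\<lambda>i. [:i ^ s, 1:] :: nat poly"] by simp
  then have top: "stirling_level s n (Suc n) = 0"
    by (simp add: stirling_level_def coeff_eq_0)
  have "(\<Sum>k\<le>Suc n. of_nat (stirling_level s (Suc n) k) * x ^ k)
      = (\<Sum>k\<le>Suc n. of_nat n ^ s * (of_nat (stirling_level s n k) * x ^ k))
      + (\<Sum>k\<le>Suc n. of_nat (case k of 0 \<Rightarrow> 0 | Suc j \<Rightarrow> stirling_level s n j) * x ^ k)"
    by (simp add: rec algebra_simps sum.distrib del: sum.atMost_Suc)
  also have "(\<Sum>k\<le>Suc n. of_nat n ^ s * (of_nat (stirling_level s n k) * x ^ k))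
      = of_nat n ^ s * (\<Sum>k\<le>n. of_nat (stirling_level s n k) * x ^ k)"
    by (simp add: top sum_distrib_left)
  also have "(\<Sum>k\<le>Suc n. of_nat (case k of 0 \<Rightarrow> 0 | Suc j \<Rightarrow> stirling_level s n j) * x ^ k)
      = x * (\<Sum>k\<le>n. of_nat (stirling_level s n k) * x ^ k)"
    by (simp add: sum.atMost_Suc_shift sum_distrib_left mult_ac del: sum.atMost_Suc)
  finally show ?case
    by (simp add: Suc.IH algebra_simps)
qed

text \<open>For \<open>i = 1\<close> the product is empty, so the value is \<open>1\<close>.\<close>

definition record_exponent :: "nat \<Rightarrow> nat \<Rightarrow> real" where
  "record_exponent s i = (\<Prod>j=2..i. (1 + (real j - 2) ^ s) / (real j - 1) ^ s)"

text \<open>Sequences are indexed from \<open>1\<close>; their value at \<open>0\<close> plays no role.\<close>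

definition is_record :: "(nat \<Rightarrow> real) \<Rightarrow> nat \<Rightarrow> bool" where
  "is_record x j \<longleftrightarrow> (\<forall>i\<in>{1..<j}. x j > x i)"

definition num_records :: "(nat \<Rightarrow> real) \<Rightarrow> nat \<Rightarrow> nat" where
  "num_records x n = card {j \<in> {1..n}. is_record x j}"

end

theory Submission imports Defs begin

text \<open>The exponents are chosen so that \<open>A n = \<alpha> 1 + \<dots> + \<alpha> n = \<alpha> (n + 1) * n ^ s\<close>. Strengthening the claim to
  \<open>P (N n = k, max (X 1, \<dots>, X n) \<le> x) = p n k * F x powr A n\<close> makes it provable by induction on \<open>n\<close>:
  conditioning on \<open>X (n + 1) = y\<close>, whose law has the continuous cdf \<open>C = F powr \<alpha> (n + 1)\<close>, the
  probability that \<open>N n = k\<close> and \<open>X (n + 1) \<le> x\<close> is a record is the integral of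
  \<open>p n k * C y powr n ^ s\<close> over \<open>y \<le> x\<close>, i.e. \<open>p n k * F x powr A (n + 1) / (1 + n ^ s)\<close>. This
  turns the recurrence of the Stirling numbers of level \<open>s\<close> into that of \<open>p\<close>; finally
  \<open>x\<close> tends to infinity.\<close>

section \<open>Stirling numbers of level s and partial sums of the exponents\<close>

lemma stirling_level_Suc_Suc:
  "stirling_level s (Suc n) (Suc k) = n ^ s * stirling_level s n (Suc k) + stirling_level s n k"
  by (simp add: stirling_level_def mult.commute [of _ "[:n ^ s, 1:]"] coeff_pCons)

text \<open>The factor with index 0 is x itself, since \<open>0 ^ s = 0\<close> for positive s;
  hence the product vanishes at 0.\<close>

lemma stirling_level_0_right:
  assumes "s \<ge> 1" "n \<ge> 1"
  shows "stirling_level s n 0 = 0"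
proof -
  have "poly (\<Prod>i<n. [:i ^ s, 1:]) 0 = 0"
    using assms by (auto simp: poly_prod intro!: bexI[of _ 0])
  then show ?thesis
    by (simp add: stirling_level_def poly_0_coeff_0)
qed

lemma stirling_level_1: "s \<ge> 1 \<Longrightarrow> stirling_level s 1 k = (if k = 1 then 1 else 0)"
  by (auto simp: stirling_level_def coeff_pCons split: nat.split)

lemma record_exponent_Suc:
  "n \<ge> 1 \<Longrightarrow> record_exponent s (Suc n) = record_exponent s n * ((1 + (real n - 1) ^ s) / real n ^ s)"
  by (simp add: record_exponent_def)

lemma record_exponent_1: "record_exponent s (Suc 0) = 1"
  by (simp add: record_exponent_def)

lemma record_exponent_pos: "record_exponent s i > 0"
  unfolding record_exponent_def
  by (intro prod_pos) (auto intro!: divide_pos_pos add_pos_nonneg)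

text \<open>The induction step is \<open>record_exponent s (n + 1) * (n ^ s + 1) = record_exponent s
  (n + 2) * (n + 1) ^ s\<close>, which is the defining recurrence of the exponents. The base case
  needs \<open>0 ^ s = 0\<close>.\<close>

lemma sum_record_exponent:
  assumes "s \<ge> 1" "n \<ge> 1"
  shows "(\<Sum>i=1..n. record_exponent s i) = record_exponent s (Suc n) * real n ^ s"
  using assms(2)
proof (induction n rule: nat_induct_at_least)
  case base
  then show ?case
    using assms(1) by (simp add: record_exponent_Suc record_exponent_1)
next
  case (Suc n)
  then show ?case
    by (simp add: record_exponent_Suc[of "Suc n"] field_simps)
qed

section \<open>Counting records\<close>

lemma is_record_cong:
  assumes "\<And>i. i \<in> {1..j} \<Longrightarrow> x i = y i" "j \<ge> 1"
  shows "is_record x j = is_record y j"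
  using assms unfolding is_record_def by auto

text \<open>This allows the count to be evaluated on a vector restricted to the first n
  indices.\<close>

lemma num_records_cong:
  assumes "\<And>i. i \<in> {1..n} \<Longrightarrow> x i = y i"
  shows "num_records x n = num_records y n"
proof -
  have "{j \<in> {1..n}. is_record x j} = {j \<in> {1..n}. is_record y j}"
    using assms by (intro Collect_cong conj_cong refl is_record_cong) auto
  then show ?thesis
    by (simp add: num_records_def)
qed

lemma num_records_Suc:
  "num_records x (Suc n) = num_records x n + (if \<forall>i\<in>{1..n}. x i < x (Suc n) then 1 else 0)"
proof -
  have rec: "is_record x (Suc n) \<longleftrightarrow> (\<forall>i\<in>{1..n}. x i < x (Suc n))"
    by (auto simp: is_record_def)
  have "{j \<in> {1..Suc n}. is_record x j} =
      (if is_record x (Suc n) then insert (Suc n) {j \<in> {1..n}. is_record x j}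
       else {j \<in> {1..n}. is_record x j})"
    by (auto simp: le_Suc_eq)
  then show ?thesis
    by (simp add: num_records_def rec)
qed

lemma num_records_1: "num_records x (Suc 0) = 1"
  by (simp add: num_records_Suc) (simp add: num_records_def)

lemma num_records_ge_1: "n \<ge> 1 \<Longrightarrow> num_records x n \<ge> 1"
  by (induction n rule: nat_induct_at_least) (simp_all add: num_records_1 num_records_Suc)

text \<open>The general family \<open>f\<close> covers both the variables on the probability space
  and the coordinates of a product space.\<close>

lemma measurable_num_records:
  assumes "\<And>i. i \<in> {1..n} \<Longrightarrow> (\<lambda>\<omega>. f \<omega> i) \<in> borel_measurable N"
  shows "(\<lambda>\<omega>. num_records (f \<omega>) n) \<in> measurable N (count_space UNIV)"
  using assms
proof (induction n)
  case 0
  then show ?case by (simp add: num_records_def)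
next
  case (Suc n)
  have [measurable]: "(\<lambda>\<omega>. num_records (f \<omega>) n) \<in> measurable N (count_space UNIV)"
    by (rule Suc.IH) (use Suc.prems in auto)
  have [measurable]: "(\<lambda>\<omega>. f \<omega> (Suc n)) \<in> borel_measurable N"
    "\<And>i. i \<in> {1..n} \<Longrightarrow> (\<lambda>\<omega>. f \<omega> i) \<in> borel_measurable N"
    using Suc.prems by auto
  show ?case
    unfolding num_records_Suc by measurable
qed

section \<open>Integration against a continuous cdf, and conditioning on an independent
  variable\<close>

text \<open>The pseudoinverse \<open>I\<close> of a continuous cdf satisfies \<open>C (I u) = u\<close> and transports the uniform
  law on \<open>(0,1)\<close> to \<open>M\<close>, which turns the integral into that of a power of \<open>u\<close> over \<open>[0, C x]\<close>.\<close>

lemma (in cdf_distribution) nn_integral_cdf_powr: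
  assumes cont: "continuous_on UNIV C" and r: "r > 0"
  shows "(\<integral>\<^sup>+y. ennreal (C y powr r) * indicator {..x} y \<partial>M) = ennreal (C x powr (r + 1) / (r + 1))"
proof -
  let ?U = "restrict_space lborel {0<..<1::real}"
  have CI: "C (I u) = u" if u: "u \<in> {0<..<1}" for u
  proof (rule antisym)
    show "u \<le> C (I u)"
      using pseudoinverse[of u "I u"] u by simp
    \<comment> \<open>Left of \<open>I u\<close> the cdf stays below u, so left-continuity at
      \<open>I u\<close> bounds \<open>C (I u)\<close> by u; a jump there would break the
      equality.\<close>
    have "(C \<longlongrightarrow> C (I u)) (at_left (I u))"
      using cont by (auto simp: continuous_on_def intro: tendsto_within_subset)
    moreover have "eventually (\<lambda>y. C y \<le> u) (at_left (I u))"
      unfolding eventually_at_filter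
    proof (intro always_eventually allI impI)
      fix y assume "y \<in> {..<I u}"
      then have "\<not> I u \<le> y" by simp
      then have "\<not> u \<le> C y" using pseudoinverse[of u y] u by simp
      then show "C y \<le> u" by simp
    qed
    ultimately show "C (I u) \<le> u"
      by (rule tendsto_upperbound) simp
  qed
  have [measurable]: "I \<in> borel_measurable ?U"
    using measurable_CI by (simp cong: measurable_cong_sets sets_restrict_space_cong)
  have "(\<integral>\<^sup>+y. ennreal (C y powr r) * indicator {..x} y \<partial>M)
      = (\<integral>\<^sup>+y. ennreal (C y powr r) * indicator {..x} y \<partial>distr ?U borel I)"
    by (simp only: distr_I_eq_M)
  also have "\<dots> = (\<integral>\<^sup>+u. ennreal (C (I u) powr r) * indicator {..x} (I u) \<partial>?U)"
    by (intro nn_integral_distr) measurable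
  \<comment> \<open>The Galois property turns \<open>I u \<le> x\<close> into
    \<open>u \<le> C x\<close>.\<close>
  also have "\<dots> = (\<integral>\<^sup>+u. ennreal (u powr r) * indicator {..C x} u \<partial>?U)"
    by (intro nn_integral_cong)
       (auto simp: space_restrict_space CI pseudoinverse[symmetric] split: split_indicator)
  also have "\<dots> = (\<integral>\<^sup>+u. ennreal (u powr r) * indicator {..C x} u * indicator {0<..<1} u \<partial>lborel)"
    by (subst nn_integral_restrict_space) auto
  \<comment> \<open>Since \<open>C x \<le> 1\<close>, the domains (0,1) cut at \<open>C x\<close>
    and [0, \<open>C x\<close>] differ at most in the null points 0 and 1.\<close>
  also have "\<dots> = (\<integral>\<^sup>+u. ennreal (u powr r * indicator {0..C x} u) \<partial>lborel)"
    using AE_lborel_singleton[of "0::real"] AE_lborel_singleton[of "1::real"]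
  proof (intro nn_integral_cong_AE, eventually_elim)
    case (elim u)
    then show ?case
      using cdf_bounded_prob[of x] by (auto split: split_indicator)
  qed
  also have "\<dots> = ennreal (C x powr (r + 1) / (r + 1))"
  proof (rule nn_integral_has_integral_lborel)
    have "((\<lambda>u. u powr r) has_integral C x powr (r + 1) / (r + 1)) {0..C x}"
      using r cdf_nonneg[of x] by (intro has_integral_powr_from_0) auto
    then show "((\<lambda>u. u powr r * indicator {0..C x} u) has_integral C x powr (r + 1) / (r + 1)) UNIV"
      by (subst (asm) has_integral_restrict_UNIV[symmetric])
         (auto elim!: has_integral_eq[rotated] split: split_indicator)
  qed (auto split: split_indicator)
  finally show ?thesis .
qed

text \<open>Independence makes the joint law a product measure, which is the integral of its slices.
  Pulling the outer integral back to \<open>M\<close> with a second sample point lets each slice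
  remain an event of \<open>M\<close>, with \<open>Y\<close> frozen.\<close>

lemma (in prob_space) emeasure_indep_var_slices:
  assumes ind: "indep_var N V L Y" and S: "S \<in> sets (N \<Otimes>\<^sub>M L)"
  shows "emeasure M {\<omega>\<in>space M. (V \<omega>, Y \<omega>) \<in> S}
    = (\<integral>\<^sup>+\<omega>'. emeasure M {\<omega>\<in>space M. (V \<omega>, Y \<omega>') \<in> S} \<partial>M)"
proof -
  have [measurable]: "V \<in> measurable M N" "Y \<in> measurable M L"
    using ind by (auto dest: indep_var_rv1 indep_var_rv2)
  interpret V: prob_space "distr M N V" by (rule prob_space_distr) simp
  interpret Y: prob_space "distr M L Y" by (rule prob_space_distr) simp
  interpret P: pair_sigma_finite "distr M N V" "distr M L Y" ..
  have "emeasure M {\<omega>\<in>space M. (V \<omega>, Y \<omega>) \<in> S}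
      = emeasure (distr M (N \<Otimes>\<^sub>M L) (\<lambda>\<omega>. (V \<omega>, Y \<omega>))) S"
    using S by (subst emeasure_distr) (auto intro!: arg_cong[where f="emeasure M"])
  also have "\<dots> = emeasure (distr M N V \<Otimes>\<^sub>M distr M L Y) S"
    using ind by (simp add: indep_var_distribution_eq)
  also have "\<dots> = (\<integral>\<^sup>+y. emeasure (distr M N V) ((\<lambda>v. (v, y)) -` S) \<partial>distr M L Y)"
    using S by (intro P.emeasure_pair_measure_alt2) simp
  also have "\<dots> = (\<integral>\<^sup>+\<omega>'. emeasure (distr M N V) ((\<lambda>v. (v, Y \<omega>')) -` S) \<partial>M)"
    using S P.measurable_emeasure_Pair2[of S] by (intro nn_integral_distr) simp_all
  also have "\<dots> = (\<integral>\<^sup>+\<omega>'. emeasure M {\<omega>\<in>space M. (V \<omega>, Y \<omega>') \<in> S} \<partial>M)"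
  proof (intro nn_integral_cong)
    fix \<omega>'
    show "emeasure (distr M N V) ((\<lambda>v. (v, Y \<omega>')) -` S) = emeasure M {\<omega>\<in>space M. (V \<omega>, Y \<omega>') \<in> S}"
      using sets_Pair2[OF S, of "Y \<omega>'"]
      by (subst emeasure_distr) (auto intro!: arg_cong[where f="emeasure M"])
  qed
  finally show ?thesis .
qed

section \<open>Joint law of the record count and the running maximum\<close>

theorem mainTheorem1:
  fixes M :: "'a measure"
    and X :: "nat \<Rightarrow> 'a \<Rightarrow> real"
    and F :: "real \<Rightarrow> real"
    and s n k :: nat
  assumes "s \<ge> 1"
    and "prob_space M"
    and "mono F"
    and "continuous_on UNIV F"
    and "(F \<longlongrightarrow> 0) at_bot"
    and "(F \<longlongrightarrow> 1) at_top"
    and "prob_space.indep_vars M (\<lambda>_. borel) X {1..}"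
    and "\<And>i x. i \<ge> 1 \<Longrightarrow> cdf (distr M borel (X i)) x = F x powr record_exponent s i"
    and "n \<ge> 1"
    and "1 \<le> k" and "k \<le> n"
  shows "measure M {\<omega> \<in> space M. num_records (\<lambda>i. X i \<omega>) n = k}
    = real (stirling_level s n k) / (\<Prod>i=1..n. 1 + (real i - 1) ^ s)"
proof -
  interpret prob_space M by fact
  have s: "s \<ge> 1" by fact
  have F_nonneg: "F x \<ge> 0" for x
  proof (rule tendsto_upperbound[OF assms(5)])
    show "\<forall>\<^sub>F y in at_bot. F y \<le> F x"
      using eventually_le_at_bot[of x] by eventually_elim (rule monoD[OF assms(3)])
  qed simp
  have X_meas: "X i \<in> borel_measurable M" if "i \<ge> 1" for i
    using assms(7) that by (auto simp: indep_vars_def)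
  define \<alpha> where "\<alpha> = record_exponent s"
  have \<alpha>_pos: "\<alpha> i > 0" for i
    by (simp add: \<alpha>_def record_exponent_pos)
  define A where "A n = (\<Sum>i=1..n. \<alpha> i)" for n
  define D where "D i = distr M borel (X i)" for i
  have D: "cdf_distribution (D i)" if "i \<ge> 1" for i
    unfolding D_def cdf_distribution_def using X_meas[OF that] by (rule real_distribution_distr)
  have cdf_D: "cdf (D i) = (\<lambda>x. F x powr \<alpha> i)" if "i \<ge> 1" for i
    using assms(8)[OF that] by (auto simp: D_def \<alpha>_def)
  have cont: "continuous_on UNIV (cdf (D i))" if "i \<ge> 1" for i
    unfolding cdf_D[OF that] using assms(4) F_nonneg \<alpha>_pos
    by (intro continuous_on_powr') auto
  \<comment> \<open>A continuous cdf gives no mass to points, so hitting a fixed level is a null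
    event.\<close>
  have no_atom: "AE \<omega> in M. X i \<omega> \<noteq> y" if i: "i \<ge> 1" for i y
  proof -
    interpret D: cdf_distribution "D i" by (rule D[OF i])
    have "isCont (cdf (D i)) y"
      using cont[OF i] by (simp add: continuous_on_eq_continuous_at)
    then have "measure (D i) {y} = 0"
      by (simp add: D.isCont_cdf)
    then have "AE z in D i. z \<noteq> y"
      by (intro AE_I[of _ _ "{y}"]) (auto simp: D.emeasure_eq_measure)
    then show ?thesis
      unfolding D_def using X_meas[OF i] by (subst (asm) AE_distr_iff) auto
  qed
  define N where "N n \<omega> = num_records (\<lambda>i. X i \<omega>) n" for n \<omega>
  have N_meas [measurable]: "N n \<in> measurable M (count_space UNIV)" for n
    unfolding N_def[abs_def] using X_meas by (intro measurable_num_records) auto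
  have [measurable]: "X (Suc i) \<in> borel_measurable M" for i
    by (rule X_meas) simp
  define p where "p n k = real (stirling_level s n k) / (\<Prod>i=1..n. 1 + (real i - 1) ^ s)" for n k
  have p_nonneg: "p n k \<ge> 0" for n k
    unfolding p_def by (intro divide_nonneg_nonneg prod_nonneg) (auto intro!: add_nonneg_nonneg)
  \<comment> \<open>This is the law of a count that grows by one with probability
    \<open>1 / (1 + n ^ s)\<close>, whatever its current value.\<close>
  have p_rec: "p (Suc n) (Suc k) = (real n ^ s * p n (Suc k) + p n k) / (1 + real n ^ s)" for n k
    by (simp add: p_def stirling_level_Suc_Suc add_divide_distrib)

  \<comment> \<open>The product form says that the count is independent of the running maximum,
    whose cdf is \<open>F powr A n\<close>. Both k and x are generalised, because the step uses
    other counts and the random level \<open>X (Suc n)\<close>.\<close>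
  have joint: "prob {\<omega>\<in>space M. N n \<omega> = k \<and> (\<forall>i\<in>{1..n}. X i \<omega> \<le> x)} = p n k * F x powr A n"
    if "n \<ge> 1" for n k x
    using that
  proof (induction n arbitrary: k x rule: nat_induct_at_least)
    case base
    have "prob {\<omega>\<in>space M. X 1 \<omega> \<le> x} = cdf (D 1) x"
      unfolding D_def cdf_def using X_meas[of 1]
      by (subst measure_distr) (auto intro!: arg_cong[where f=prob])
    then show ?case
      using s by (auto simp: N_def num_records_1 p_def stirling_level_1[unfolded One_nat_def] A_def cdf_D power_0_left)
  next
    case (Suc n)
    have [measurable]: "X i \<in> borel_measurable M" if "i \<in> {1..n}" for i
      using X_meas that by simp
    define a where "a = \<alpha> (Suc n)"
    \<comment> \<open>Hence \<open>F powr A n\<close> is the \<open>n ^ s\<close>-th power of the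
      cdf of the new variable.\<close>
    have A: "A n = a * real n ^ s"
      unfolding A_def \<alpha>_def a_def using s Suc.hyps by (rule sum_record_exponent)
    have A_Suc: "A (Suc n) = A n + a"
      by (simp add: A_def a_def)
    let ?Y = "X (Suc n)"
    \<comment> \<open>Past and new variable are packed as vectors over disjoint index sets, so that
      independence of the family yields independence of \<open>V\<close> and
      \<open>W\<close>.\<close>
    define V where "V \<omega> = (\<lambda>i\<in>{1..n}. X i \<omega>)" for \<omega>
    define W where "W \<omega> = (\<lambda>i\<in>{Suc n}. X i \<omega>)" for \<omega>
    let ?P = "PiM {1..n} (\<lambda>_. borel) :: (nat \<Rightarrow> real) measure"
    let ?P' = "PiM {Suc n} (\<lambda>_. borel) :: (nat \<Rightarrow> real) measure"
    have NV: "num_records (V \<omega>) n = N n \<omega>" for \<omega>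
      unfolding N_def by (rule num_records_cong) (simp add: V_def)
    have VX: "V \<omega> i = X i \<omega>" if "i \<in> {1..n}" for i \<omega>
      using that by (simp add: V_def)
    have WX: "W \<omega> (Suc n) = ?Y \<omega>" for \<omega>
      by (simp add: W_def)
    have VW: "V \<omega> \<in> space ?P" "W \<omega> \<in> space ?P'" for \<omega>
      by (simp_all add: V_def W_def space_PiM)
    have ind: "indep_var ?P V ?P' W"
      unfolding V_def[abs_def] W_def[abs_def] using assms(7) by (rule indep_var_restrict) auto
    have [measurable]: "(\<lambda>z. num_records (fst z) n) \<in> measurable (?P \<Otimes>\<^sub>M ?P') (count_space UNIV)"
      by (rule measurable_num_records) auto
    \<comment> \<open>A record requires strict inequalities, whereas the induction hypothesis has
      weak ones; the two events agree almost surely.\<close>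
    have lt: "emeasure M {\<omega>\<in>space M. N n \<omega> = j \<and> (\<forall>i\<in>{1..n}. X i \<omega> < y)} = ennreal (p n j * F y powr A n)" for j y
    proof -
      have "AE \<omega> in M. \<forall>i\<in>{1..n}. X i \<omega> \<noteq> y"
        using no_atom by (intro AE_finite_allI) auto
      then have "emeasure M {\<omega>\<in>space M. N n \<omega> = j \<and> (\<forall>i\<in>{1..n}. X i \<omega> < y)}
          = emeasure M {\<omega>\<in>space M. N n \<omega> = j \<and> (\<forall>i\<in>{1..n}. X i \<omega> \<le> y)}"
      proof (intro emeasure_eq_AE)
        show "{\<omega>\<in>space M. N n \<omega> = j \<and> (\<forall>i\<in>{1..n}. X i \<omega> < y)} \<in> events"
          by measurable
        show "{\<omega>\<in>space M. N n \<omega> = j \<and> (\<forall>i\<in>{1..n}. X i \<omega> \<le> y)} \<in> events"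
          by measurable
      qed (auto elim!: eventually_mono simp: less_le)
      then show ?thesis
        by (simp add: emeasure_eq_measure Suc.IH del: One_nat_def)
    qed
    interpret D: cdf_distribution "D (Suc n)" by (rule D) simp
    have D_Suc: "D (Suc n) = distr M borel ?Y"
      by (simp add: D_def)
    have Q: "prob {\<omega>\<in>space M. N n \<omega> = j \<and> (\<forall>i\<in>{1..n}. X i \<omega> < ?Y \<omega>) \<and> ?Y \<omega> \<le> x}
        = p n j * F x powr A (Suc n) / (1 + real n ^ s)" for j
    proof -
      \<comment> \<open>\<open>?g y\<close> is the probability of the event when the new variable is
        frozen at y, written through its own cdf to fit \<open>nn_integral_cdf_powr\<close> with
        \<open>r = n ^ s\<close>.\<close>
      let ?g = "\<lambda>y. ennreal (p n j) * (ennreal (cdf (D (Suc n)) y powr real n ^ s) * indicator {..x} y)"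
      let ?S = "{z\<in>space (?P \<Otimes>\<^sub>M ?P'). num_records (fst z) n = j \<and> (\<forall>i\<in>{1..n}. fst z i < snd z (Suc n)) \<and> snd z (Suc n) \<le> x}"
      have S: "?S \<in> sets (?P \<Otimes>\<^sub>M ?P')" by measurable
      have mem: "(V \<omega>, W \<omega>') \<in> ?S \<longleftrightarrow> N n \<omega> = j \<and> (\<forall>i\<in>{1..n}. X i \<omega> < ?Y \<omega>') \<and> ?Y \<omega>' \<le> x" for \<omega> \<omega>'
        using VW by (auto simp: NV VX WX space_pair_measure)
      have "emeasure M {\<omega>\<in>space M. N n \<omega> = j \<and> (\<forall>i\<in>{1..n}. X i \<omega> < ?Y \<omega>) \<and> ?Y \<omega> \<le> x}
          = (\<integral>\<^sup>+\<omega>'. emeasure M {\<omega>\<in>space M. N n \<omega> = j \<and> (\<forall>i\<in>{1..n}. X i \<omega> < ?Y \<omega>') \<and> ?Y \<omega>' \<le> x} \<partial>M)"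
        using emeasure_indep_var_slices[OF ind S] by (simp only: mem)
      also have "\<dots> = (\<integral>\<^sup>+\<omega>'. ?g (?Y \<omega>') \<partial>M)"
      proof (intro nn_integral_cong)
        fix \<omega>'
        have "F y powr A n = cdf (D (Suc n)) y powr real n ^ s" for y
          by (simp add: cdf_D powr_powr A a_def)
        then show "emeasure M {\<omega>\<in>space M. N n \<omega> = j \<and> (\<forall>i\<in>{1..n}. X i \<omega> < ?Y \<omega>') \<and> ?Y \<omega>' \<le> x} = ?g (?Y \<omega>')"
          by (cases "?Y \<omega>' \<le> x") (simp_all add: lt ennreal_mult p_nonneg del: One_nat_def)
      qed
      also have "\<dots> = (\<integral>\<^sup>+y. ?g y \<partial>D (Suc n))"
        unfolding D_Suc by (intro nn_integral_distr[symmetric]) (simp_all add: D_Suc[symmetric])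
      also have "\<dots> = ennreal (p n j) * (\<integral>\<^sup>+y. ennreal (cdf (D (Suc n)) y powr real n ^ s) * indicator {..x} y \<partial>D (Suc n))"
        by (intro nn_integral_cmult) simp
      also have "\<dots> = ennreal (p n j) * ennreal (cdf (D (Suc n)) x powr (real n ^ s + 1) / (real n ^ s + 1))"
        using Suc.hyps by (subst D.nn_integral_cdf_powr) (auto intro: cont)
      \<comment> \<open>The exponents match because
        \<open>a * (n ^ s + 1) = A n + a = A (Suc n)\<close>.\<close>
      also have "cdf (D (Suc n)) x powr (real n ^ s + 1) = F x powr A (Suc n)"
        by (simp add: cdf_D powr_powr A_Suc A a_def algebra_simps)
      finally have "emeasure M {\<omega>\<in>space M. N n \<omega> = j \<and> (\<forall>i\<in>{1..n}. X i \<omega> < ?Y \<omega>) \<and> ?Y \<omega> \<le> x}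
          = ennreal (p n j * F x powr A (Suc n) / (1 + real n ^ s))"
        by (simp add: ennreal_mult[symmetric] p_nonneg add.commute)
      then show ?thesis
        by (simp add: measure_def p_nonneg add_nonneg_nonneg)
    qed
    \<comment> \<open>No comparison between past and new variable occurs here, so the slice is
      constant in y up to x and the probabilities simply multiply.\<close>
    have R: "prob {\<omega>\<in>space M. N n \<omega> = j \<and> (\<forall>i\<in>{1..n}. X i \<omega> \<le> x) \<and> ?Y \<omega> \<le> x}
        = p n j * F x powr A (Suc n)" for j
    proof -
      let ?S = "{z\<in>space (?P \<Otimes>\<^sub>M ?P'). num_records (fst z) n = j \<and> (\<forall>i\<in>{1..n}. fst z i \<le> x) \<and> snd z (Suc n) \<le> x}"
      have S: "?S \<in> sets (?P \<Otimes>\<^sub>M ?P')" by measurable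
      have mem: "(V \<omega>, W \<omega>') \<in> ?S \<longleftrightarrow> N n \<omega> = j \<and> (\<forall>i\<in>{1..n}. X i \<omega> \<le> x) \<and> ?Y \<omega>' \<le> x" for \<omega> \<omega>'
        using VW by (auto simp: NV VX WX space_pair_measure)
      have "emeasure M {\<omega>\<in>space M. N n \<omega> = j \<and> (\<forall>i\<in>{1..n}. X i \<omega> \<le> x) \<and> ?Y \<omega> \<le> x}
          = (\<integral>\<^sup>+\<omega>'. emeasure M {\<omega>\<in>space M. N n \<omega> = j \<and> (\<forall>i\<in>{1..n}. X i \<omega> \<le> x) \<and> ?Y \<omega>' \<le> x} \<partial>M)"
        using emeasure_indep_var_slices[OF ind S] by (simp only: mem)
      also have "\<dots> = (\<integral>\<^sup>+\<omega>'. ennreal (p n j * F x powr A n) * indicator {..x} (?Y \<omega>') \<partial>M)"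
        by (intro nn_integral_cong) (auto simp: emeasure_eq_measure Suc.IH simp del: One_nat_def split: split_indicator)
      also have "\<dots> = (\<integral>\<^sup>+y. ennreal (p n j * F x powr A n) * indicator {..x} y \<partial>D (Suc n))"
        unfolding D_Suc by (intro nn_integral_distr[symmetric]) simp_all
      also have "\<dots> = ennreal (p n j * F x powr A n) * ennreal (cdf (D (Suc n)) x)"
        by (subst nn_integral_cmult_indicator) (auto simp: D.emeasure_eq_measure cdf_def)
      also have "\<dots> = ennreal (p n j * F x powr A (Suc n))"
        by (simp add: cdf_D a_def A_Suc powr_add ennreal_mult[symmetric] p_nonneg mult.assoc)
      finally show ?thesis
        by (simp add: measure_def p_nonneg)
    qed
    show ?case
    proof (cases k)
      \<comment> \<open>Both sides vanish: the first variable is always a record, and the Stirling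
        number at 0 is zero.\<close>
      case 0
      have "N (Suc n) \<omega> \<noteq> 0" for \<omega>
        using num_records_ge_1[of "Suc n" "\<lambda>i. X i \<omega>"] by (simp add: N_def)
      then have "{\<omega>\<in>space M. N (Suc n) \<omega> = k \<and> (\<forall>i\<in>{1..Suc n}. X i \<omega> \<le> x)} = {}"
        using 0 by blast
      then show ?thesis
        using s 0 by (simp only: measure_empty) (simp add: p_def stirling_level_0_right)
    next
      case k: (Suc j)
      define B where "B \<omega> \<longleftrightarrow> (\<forall>i\<in>{1..n}. X i \<omega> < ?Y \<omega>)" for \<omega>
      define L where "L \<omega> \<longleftrightarrow> (\<forall>i\<in>{1..n}. X i \<omega> \<le> x)" for \<omega>
      have [measurable]: "Measurable.pred M B" "Measurable.pred M L"
        unfolding B_def[abs_def] L_def[abs_def] by measurable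
      have BL: "L \<omega>" if "B \<omega>" "?Y \<omega> \<le> x" for \<omega>
        using that unfolding B_def L_def by (meson less_imp_le less_le_trans)
      let ?R = "{\<omega>\<in>space M. N n \<omega> = k \<and> L \<omega> \<and> ?Y \<omega> \<le> x}"
      let ?Q = "\<lambda>j. {\<omega>\<in>space M. N n \<omega> = j \<and> B \<omega> \<and> ?Y \<omega> \<le> x}"
      have upto: "(\<forall>i\<in>{1..Suc n}. X i \<omega> \<le> x) \<longleftrightarrow> L \<omega> \<and> ?Y \<omega> \<le> x" for \<omega>
        unfolding L_def by (simp add: atLeastAtMostSuc_conv conj_commute)
      have N_Suc: "N (Suc n) \<omega> = N n \<omega> + (if B \<omega> then 1 else 0)" for \<omega>
        unfolding N_def B_def by (rule num_records_Suc)
      \<comment> \<open>Either there were k records and no new one occurs (\<open>?R\<close> without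
        \<open>?Q k\<close>), or there were j and a new one occurs (\<open>?Q j\<close>). A record
        at most x forces all earlier values below x, so \<open>?Q k\<close> lies inside
        \<open>?R\<close>.\<close>
      have "{\<omega>\<in>space M. N (Suc n) \<omega> = k \<and> (\<forall>i\<in>{1..Suc n}. X i \<omega> \<le> x)} = (?R - ?Q k) \<union> ?Q j"
        unfolding upto N_Suc k by (auto dest: BL)
      moreover have "prob ((?R - ?Q k) \<union> ?Q j) = prob (?R - ?Q k) + prob (?Q j)"
      proof (rule finite_measure_Union)
        show "?R - ?Q k \<in> events" "?Q j \<in> events" by measurable
      qed (auto simp: k)
      moreover have "prob (?R - ?Q k) = prob ?R - prob (?Q k)"
      proof (rule finite_measure_Diff)
        show "?R \<in> events" "?Q k \<in> events" by measurable
      qed (auto dest: BL)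
      ultimately have "prob {\<omega>\<in>space M. N (Suc n) \<omega> = k \<and> (\<forall>i\<in>{1..Suc n}. X i \<omega> \<le> x)}
          = p n k * F x powr A (Suc n) - p n k * F x powr A (Suc n) / (1 + real n ^ s)
            + p n j * F x powr A (Suc n) / (1 + real n ^ s)"
        using R[of k, folded L_def] Q[of k, folded B_def] Q[of j, folded B_def] by simp
      \<comment> \<open>The factor \<open>1 - 1 / (1 + n ^ s)\<close> equals
        \<open>n ^ s / (1 + n ^ s)\<close>, the weight of \<open>p n k\<close> in
        \<open>p_rec\<close>.\<close>
      also have "\<dots> = p (Suc n) k * F x powr A (Suc n)"
      proof -
        have "1 + real n ^ s > 0"
          by (intro add_pos_nonneg) simp_all
        then show ?thesis
          unfolding k p_rec by (simp add: divide_simps) (simp add: algebra_simps)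
      qed
      finally show ?thesis .
    qed
  qed

  have [measurable]: "X i \<in> borel_measurable M" if "i \<in> {1..n}" for i
    using X_meas that by simp
  \<comment> \<open>Integer levels suffice: finitely many real values always lie below some natural
    number, so the events increase to the one without a bound and continuity from below
    applies.\<close>
  let ?E = "\<lambda>m::nat. {\<omega>\<in>space M. N n \<omega> = k \<and> (\<forall>i\<in>{1..n}. X i \<omega> \<le> real m)}"
  have "(\<lambda>m. prob (?E m)) \<longlonglongrightarrow> prob (\<Union>m. ?E m)"
  proof (rule finite_Lim_measure_incseq)
    show "range ?E \<subseteq> events" by auto
    show "incseq ?E"
      by (intro monoI) (auto intro: order_trans of_nat_mono)
  qed
  moreover have "(\<Union>m. ?E m) = {\<omega>\<in>space M. N n \<omega> = k}"
  proof -
    have "\<exists>m::nat. \<forall>i\<in>{1..n}. X i \<omega> \<le> real m" for \<omega>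
    proof -
      obtain m :: nat where "Max (insert 0 ((\<lambda>i. X i \<omega>) ` {1..n})) \<le> real m"
        using real_arch_simple by blast
      then show ?thesis by (auto intro!: exI[of _ m])
    qed
    then show ?thesis by auto
  qed
  moreover have "(\<lambda>m. prob (?E m)) \<longlonglongrightarrow> p n k"
  proof -
    have "(\<lambda>m. F (real m)) \<longlonglongrightarrow> 1"
      using assms(6) filterlim_real_sequentially by (rule filterlim_compose)
    then have "(\<lambda>m. p n k * F (real m) powr A n) \<longlonglongrightarrow> p n k * 1 powr A n"
      by (intro tendsto_intros) auto
    then show ?thesis
      by (simp add: joint[OF assms(9)] del: One_nat_def)
  qed
  ultimately have "prob {\<omega>\<in>space M. N n \<omega> = k} = p n k"
    by (simp only: LIMSEQ_unique)
  then show ?thesis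
    by (simp add: N_def p_def)
qed

end
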